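(* Let $A$ and $B$ be closed and convex subsets of a real Hilbert space $\mathcal H$. Assume that $\lambda,\mu>0$, $\lambda\mu<4$ and that $A\cap B\neq\emptyset$. Let $z\in A\cap B$ and let $r>0$. Let $(P_B)_\mu(P_A)_\lambda$ denote the composition of the relaxed metric projections ($(P_A)_\lambda$ applied first). The following statements hold: (i) The operator $(P_B)_\mu(P_A)_\lambda$ is weakly regular over $B(z,r)$. (ii) If $\{A,B\}$ is regular over $B(z,r)$, then the operator $(P_B)_\mu(P_A)_\lambda$ is regular over $B(z,r)$. (iii) If $\{A,B\}$ is $\kappa$-linearly regular over $B(z,r)$, then the operator $(P_B)_\mu(P_A)_\lambda$ is $\delta$-linearly regular over $B(z,r)$, where $$\delta:=\left(\frac{|\alpha|\min\{\lambda,\mu\}}{2\kappa(1+\beta\sqrt\nu)}\right)^2,\qquad \nu:=\frac{4(\lambda+\mu-\lambda\mu)}{4-\lambda\mu},$$ $$\alpha:=\sqrt{\tfrac1\lambda-\tfrac1\nu}-\sqrt{\tfrac1\mu-\tfrac1\nu}\neq0,\qquad \beta:=\max\left\{\sqrt{\tfrac1\lambda-\tfrac1\nu},\ \sqrt{\tfrac1\mu-\tfrac1\nu}\right\}>0.$$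
   Context: $P_C$ is the metric projection onto a nonempty closed convex set $C$, and $(P_C)_\lambda:=\operatorname{Id}+\lambda(P_C-\operatorname{Id})$. $\operatorname{Fix}T:=\{x\in\mathcal H: T(x)=x\}$; $B(z,r)$ (with two arguments) is the closed ball with center $z$ and radius $r$; $d(x,C):=\inf_{c\in C}\|x-c\|$; $\rightharpoonup$ denotes weak convergence. For $\lambda,\mu>0$ with $\lambda\mu<4$ one has $\nu\ge\max\{\lambda,\mu\}>0$, so the square roots are well defined. Regularity of operators. Let $S\subseteq\mathcal H$ be nonempty. An operator $T\colon\mathcal H\to\mathcal H$ is: - weakly regular over $S$ if for every sequence $\{x^k\}\subseteq S$: $x^k\rightharpoonup y$ and $\|T(x^k)-x^k\|\to0$ imply $y\in\operatorname{Fix}T$; - regular over $S$ if for every sequence $\{x^k\}\subseteq S$: $\|T(x^k)-x^k\|\to0$ implies $d(x^k,\operatorname{Fix}T)\to0$; - $\delta$-linearly regular over $S$, where $\delta>0$, if $\|T(x)-x\|\ge\delta\, d(x,\operatorname{Fix}T)$ for all $x\in S$. Regularity of sets. Let $A,B\subseteq\mathcal H$ be closed and convex with $A\cap B\ne\emptyset$ and $S\subseteq\mathcal H$ nonempty. The pair $\{A,B\}$ is: - regular over $S$ if for every sequence $\{x^k\}\subseteq S$: $\max\{d(x^k,A),d(x^k,B)\}\to0$ implies $d(x^k,A\cap B)\to0$; - $\kappa$-linearly regular over $S$, where $\kappa>0$, if $d(x,A\cap B)\le\kappa\max\{d(x,A),d(x,B)\}$ for all $x\in S$.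
   Formalization: Part (iii), including the claim α ≠ 0, is stated only for λ ≠ μ: when λ = μ the two square roots coincide, so α = 0 and δ = 0, contradicting α ≠ 0 and the requirement δ > 0; (i), (ii) and β > 0 are stated for all λ, μ. *)

theory Defs
  imports "HOL-Analysis.Analysis"
begin

text \<open>
  A real Hilbert space is a type of class \<^class>\<open>real_inner\<close> and \<^class>\<open>complete_space\<close>.
  The library's \<^const>\<open>closest_point\<close> is restricted to \<^class>\<open>heine_borel\<close> types, i.e. to finite
  dimension, so the metric projection is introduced here. The minimiser exists and is unique for
  a nonempty closed convex set in a Hilbert space; the value is unspecified for other sets.
\<close>

definition metric_proj :: "'a::{real_inner,complete_space} set \<Rightarrow> 'a \<Rightarrow> 'a"
  where "metric_proj C x = (THE p. p \<in> C \<and> (\<forall>c\<in>C. norm (x - p) \<le> norm (x - c)))"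

definition relaxation :: "('a::real_vector \<Rightarrow> 'a) \<Rightarrow> real \<Rightarrow> 'a \<Rightarrow> 'a"
  where "relaxation T t x = x + t *\<^sub>R (T x - x)"

definition Fix :: "('a \<Rightarrow> 'a) \<Rightarrow> 'a set"
  where "Fix T = {x. T x = x}"

definition weakly_converges :: "(nat \<Rightarrow> 'a::real_inner) \<Rightarrow> 'a \<Rightarrow> bool"
  where "weakly_converges x y \<longleftrightarrow> (\<forall>u. (\<lambda>k. x k \<bullet> u) \<longlonglongrightarrow> y \<bullet> u)"

text \<open>
  The distance \<open>d(x, C)\<close> is \<^const>\<open>infdist\<close>, which is 0 by convention for empty \<open>C\<close>. The
  notions below are therefore only meaningful when \<^term>\<open>Fix T\<close> and \<^term>\<open>A \<inter> B\<close>, respectively,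
  are nonempty. The pair notions are meant for closed convex sets.
\<close>

definition weakly_regular_op :: "('a::real_inner \<Rightarrow> 'a) \<Rightarrow> 'a set \<Rightarrow> bool"
  where "weakly_regular_op T S \<longleftrightarrow>
    (\<forall>x y. (\<forall>k. x k \<in> S) \<longrightarrow> weakly_converges x y \<longrightarrow>
       (\<lambda>k. norm (T (x k) - x k)) \<longlonglongrightarrow> 0 \<longrightarrow> y \<in> Fix T)"

definition regular_op :: "('a::real_inner \<Rightarrow> 'a) \<Rightarrow> 'a set \<Rightarrow> bool"
  where "regular_op T S \<longleftrightarrow>
    (\<forall>x :: nat \<Rightarrow> 'a. (\<forall>k. x k \<in> S) \<longrightarrow> (\<lambda>k. norm (T (x k) - x k)) \<longlonglongrightarrow> 0 \<longrightarrow>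
       (\<lambda>k. infdist (x k) (Fix T)) \<longlonglongrightarrow> 0)"

definition linearly_regular_op :: "real \<Rightarrow> ('a::real_inner \<Rightarrow> 'a) \<Rightarrow> 'a set \<Rightarrow> bool"
  where "linearly_regular_op \<delta> T S \<longleftrightarrow>
    \<delta> > 0 \<and> (\<forall>x\<in>S. norm (T x - x) \<ge> \<delta> * infdist x (Fix T))"

definition regular_pair :: "'a::real_inner set \<Rightarrow> 'a set \<Rightarrow> 'a set \<Rightarrow> bool"
  where "regular_pair A B S \<longleftrightarrow>
    (\<forall>x :: nat \<Rightarrow> 'a. (\<forall>k. x k \<in> S) \<longrightarrow>
       (\<lambda>k. max (infdist (x k) A) (infdist (x k) B)) \<longlonglongrightarrow> 0 \<longrightarrow>
       (\<lambda>k. infdist (x k) (A \<inter> B)) \<longlonglongrightarrow> 0)"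

definition linearly_regular_pair :: "real \<Rightarrow> 'a::real_inner set \<Rightarrow> 'a set \<Rightarrow> 'a set \<Rightarrow> bool"
  where "linearly_regular_pair \<kappa> A B S \<longleftrightarrow>
    \<kappa> > 0 \<and> (\<forall>x\<in>S. infdist x (A \<inter> B) \<le> \<kappa> * max (infdist x A) (infdist x B))"

end

theory Submission
  imports Defs
begin

text \<open>
  Put \<open>u = \<lambda>(P_A x - x)\<close>, \<open>y = x + u\<close>, \<open>v = \<mu>(P_B y - y)\<close>, so that \<open>T x - x = u + v\<close>. The obtuse
  angle property gives, for \<open>w\<close> in both sets,
  \<open>\<langle>T x - x, w - x\<rangle> \<ge> |u|^2/\<lambda> + |v|^2/\<mu> + \<langle>u, v\<rangle>\<close>, and the right-hand side equals
  \<open>|u + v|^2/\<nu> + |s u - \<sigma> t v|^2\<close>, where \<open>s\<close> and \<open>t\<close> are the two square roots in the definition of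
  \<open>\<alpha>\<close> and \<open>\<sigma>\<close> is a sign. Hence a small displacement forces both \<open>u + v\<close> and \<open>s u - \<sigma> t v\<close> to be
  small, and as \<open>s + \<sigma> t \<noteq> 0\<close> also \<open>u\<close> and \<open>v\<close>, that is, \<open>x\<close> is close to both sets.
\<close>

section \<open>Metric projections in Hilbert space\<close>

text \<open>The parallelogram law for \<open>x - a\<close> and \<open>x - b\<close>. In a convex set
  at distance \<open>d\<close> from \<open>x\<close>, it makes almost nearest points cluster as
  \<open>e\<close> decreases to \<open>d\<close>.\<close>

lemma norm_diff_le_midpoint:
  fixes x a b :: "'a::real_inner"
  assumes "norm (x - a) \<le> e" "norm (x - b) \<le> e" "0 \<le> d" "d \<le> norm (x - (1/2) *\<^sub>R (a + b))"
  shows "(norm (a - b))\<^sup>2 \<le> 4 * (e\<^sup>2 - d\<^sup>2)"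
proof -
  define h where "h = (1/2) *\<^sub>R (a + b)"
  have "(norm (a - b))\<^sup>2 = 2 * (norm (x - a))\<^sup>2 + 2 * (norm (x - b))\<^sup>2 - 4 * (norm (x - h))\<^sup>2"
    unfolding power2_norm_eq_inner h_def
    by (simp add: inner_diff_left inner_diff_right inner_add_left inner_add_right
        inner_commute field_simps)
  moreover have "(norm (x - a))\<^sup>2 \<le> e\<^sup>2" "(norm (x - b))\<^sup>2 \<le> e\<^sup>2"
    using assms by (auto intro: power_mono)
  moreover have "d\<^sup>2 \<le> (norm (x - h))\<^sup>2"
    using assms by (auto simp: h_def intro: power_mono)
  ultimately show ?thesis by (simp add: right_diff_distrib)
qed

text \<open>The almost nearest points \<open>S n\<close> form a decreasing sequence of nonempty
  closed sets whose diameters tend to 0. By completeness they share a point, and its distance to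
  \<open>x\<close> is at most \<open>d + 1 / Suc n\<close> for every \<open>n\<close>.\<close>

lemma closest_point_exists_complete:
  fixes C :: "'a::{real_inner,complete_space} set"
  assumes "closed C" "convex C" "C \<noteq> {}"
  shows "\<exists>p\<in>C. \<forall>c\<in>C. norm (x - p) \<le> norm (x - c)"
proof -
  define d where "d = infdist x C"
  define S where "S n = C \<inter> cball x (d + 1 / Suc n)" for n
  have d0: "0 \<le> d" by (simp add: d_def infdist_nonneg)
  have dle: "d \<le> norm (x - c)" if "c \<in> C" for c
    using infdist_le[OF that, of x] by (simp add: d_def dist_norm)
  have "\<exists>p. \<forall>n. p \<in> S n"
  proof (rule decreasing_closed_nest[of S])
    show "closed (S n)" for n
      using assms by (auto simp: S_def)
    show "S n \<noteq> {}" for n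
    proof
      assume *: "S n = {}"
      have "d + 1 / Suc n \<le> dist x c" if "c \<in> C" for c
        using * that by (fastforce simp: S_def)
      then have "d + 1 / Suc n \<le> infdist x C"
        using assms(3) by (auto simp: infdist_notempty intro: cINF_greatest)
      then show False by (simp add: d_def)
    qed
    show "S n \<subseteq> S m" if "m \<le> n" for m n
    proof -
      have "1 / real (Suc n) \<le> 1 / real (Suc m)"
        using that by (simp add: frac_le)
      then show ?thesis by (auto simp: S_def)
    qed
    \<comment> \<open>Convexity keeps midpoints in \<open>C\<close>, hence at distance at least
      \<open>d\<close> from \<open>x\<close>. The midpoint lemma then bounds the squared diameter of
      \<open>S n\<close> by an expression tending to 0.\<close>
    fix e :: real assume "e > 0"
    have "(\<lambda>n. 4 * ((d + 1 / real (Suc n))\<^sup>2 - d\<^sup>2)) \<longlonglongrightarrow> 4 * ((d + 0)\<^sup>2 - d\<^sup>2)"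
      using LIMSEQ_Suc[OF lim_1_over_n] by (intro tendsto_intros) auto
    then have "(\<lambda>n. 4 * ((d + 1 / real (Suc n))\<^sup>2 - d\<^sup>2)) \<longlonglongrightarrow> 0" by simp
    then have "eventually (\<lambda>n. 4 * ((d + 1 / real (Suc n))\<^sup>2 - d\<^sup>2) < e\<^sup>2) sequentially"
      by (rule order_tendstoD) (use \<open>e > 0\<close> in auto)
    then obtain n where n: "4 * ((d + 1 / real (Suc n))\<^sup>2 - d\<^sup>2) < e\<^sup>2"
      by (auto simp: eventually_sequentially)
    have "dist a b < e" if "a \<in> S n" "b \<in> S n" for a b
    proof -
      have "(1/2) *\<^sub>R (a + b) \<in> C"
        using that convexD[OF assms(2), of a b "1/2" "1/2"] by (simp add: S_def scaleR_add_right)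
      then have "(norm (a - b))\<^sup>2 \<le> 4 * ((d + 1 / real (Suc n))\<^sup>2 - d\<^sup>2)"
        using that d0 dle by (intro norm_diff_le_midpoint[of x]) (auto simp: S_def dist_norm)
      with n have "(norm (a - b))\<^sup>2 < e\<^sup>2" by linarith
      then show ?thesis
        using \<open>e > 0\<close> by (metis dist_norm less_eq_real_def power_less_imp_less_base)
    qed
    then show "\<exists>n. \<forall>a\<in>S n. \<forall>b\<in>S n. dist a b < e" by blast
  qed blast
  then obtain p where p: "\<And>n. p \<in> S n" by blast
  have "norm (x - p) \<le> d"
  proof (rule LIMSEQ_le_const)
    show "(\<lambda>n. d + 1 / real (Suc n)) \<longlonglongrightarrow> d"
      using tendsto_add[OF tendsto_const LIMSEQ_Suc[OF lim_1_over_n], of d] by simp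
    show "\<exists>N. \<forall>n\<ge>N. norm (x - p) \<le> d + 1 / real (Suc n)"
      using p by (auto simp: S_def dist_norm)
  qed
  moreover have "p \<in> C" using p[of 0] by (simp add: S_def)
  ultimately show ?thesis using dle by force
qed

lemma metric_proj_closest:
  assumes "closed C" "convex C" "C \<noteq> {}"
  shows "metric_proj C x \<in> C \<and> (\<forall>c\<in>C. norm (x - metric_proj C x) \<le> norm (x - c))"
  unfolding metric_proj_def
proof (rule theI')
  show "\<exists>!p. p \<in> C \<and> (\<forall>c\<in>C. norm (x - p) \<le> norm (x - c))"
    using closest_point_exists_complete[OF assms, of x]
      any_closest_point_unique[OF assms(2,1), where a = x]
    by (auto simp: dist_norm)
qed

lemma metric_proj_in:
  assumes "closed C" "convex C" "C \<noteq> {}"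
  shows "metric_proj C x \<in> C"
  using metric_proj_closest[OF assms] by blast

lemma metric_proj_dot:
  assumes "closed C" "convex C" "c \<in> C"
  shows "(x - metric_proj C x) \<bullet> (c - metric_proj C x) \<le> 0"
  using any_closest_point_dot[OF assms(2,1) _ assms(3)] metric_proj_closest[OF assms(1,2), of x]
    assms(3) by (auto simp: dist_norm)

text \<open>The obtuse angle property with \<open>c - x\<close> split at the projection; the piece
  along the displacement contributes the square.\<close>

lemma metric_proj_displacement:
  assumes "closed C" "convex C" "c \<in> C"
  shows "(norm (metric_proj C x - x))\<^sup>2 \<le> (metric_proj C x - x) \<bullet> (c - x)"
  using metric_proj_dot[OF assms, of x] unfolding power2_norm_eq_inner
  by (simp add: inner_diff_left inner_diff_right inner_commute)

lemma metric_proj_self: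
  assumes "closed C" "convex C" "c \<in> C"
  shows "metric_proj C c = c"
  using metric_proj_displacement[OF assms, of c] by simp

lemma infdist_metric_proj:
  assumes "closed C" "convex C" "C \<noteq> {}"
  shows "infdist x C = norm (x - metric_proj C x)"
proof (rule antisym)
  show "infdist x C \<le> norm (x - metric_proj C x)"
    using infdist_le[OF metric_proj_in[OF assms], of x x] by (simp add: dist_norm)
  show "norm (x - metric_proj C x) \<le> infdist x C"
    using metric_proj_closest[OF assms, of x] assms(3)
    by (auto simp: infdist_notempty dist_norm intro: cINF_greatest)
qed

text \<open>The projection \<open>q\<close> of \<open>y\<close> defines the half-space of all
  \<open>h\<close> with \<open>(h - q) \<bullet> (y - q) \<le> 0\<close>, which contains
  \<open>C\<close> and so every \<open>p k\<close>. Since \<open>x k - p k\<close> tends to 0 in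
  norm, testing weak convergence against \<open>y - q\<close> puts \<open>y\<close> itself into this
  half-space, which forces \<open>y = q\<close>.\<close>

lemma weak_limit_in_closed_convex:
  fixes C :: "'a::{real_inner,complete_space} set"
  assumes C: "closed C" "convex C" "C \<noteq> {}"
    and x: "weakly_converges x y" and d: "(\<lambda>k. infdist (x k) C) \<longlonglongrightarrow> 0"
  shows "y \<in> C"
proof -
  define q where "q = metric_proj C y"
  define p where "p k = metric_proj C (x k)" for k
  have "(\<lambda>k. x k - p k) \<longlonglongrightarrow> 0"
    using d by (simp add: tendsto_norm_zero_iff p_def infdist_metric_proj[OF C])
  then have "(\<lambda>k. (x k - p k) \<bullet> (y - q)) \<longlonglongrightarrow> 0 \<bullet> (y - q)"
    by (intro tendsto_intros)
  moreover have "(\<lambda>k. x k \<bullet> (y - q)) \<longlonglongrightarrow> y \<bullet> (y - q)"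
    using x by (simp add: weakly_converges_def)
  ultimately have "(\<lambda>k. x k \<bullet> (y - q) - q \<bullet> (y - q) - (x k - p k) \<bullet> (y - q))
      \<longlonglongrightarrow> y \<bullet> (y - q) - q \<bullet> (y - q) - 0 \<bullet> (y - q)"
    by (intro tendsto_diff tendsto_const)
  moreover have "x k \<bullet> (y - q) - q \<bullet> (y - q) - (x k - p k) \<bullet> (y - q) \<le> 0" for k
    using metric_proj_dot[OF C(1,2) metric_proj_in[OF C], of y "x k"]
    by (simp add: q_def p_def inner_diff_left inner_diff_right inner_commute)
  ultimately have "y \<bullet> (y - q) - q \<bullet> (y - q) - 0 \<bullet> (y - q) \<le> 0"
    by (intro LIMSEQ_le_const2) auto
  then have "(y - q) \<bullet> (y - q) \<le> 0"
    by (simp add: inner_diff_left)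
  then have "y = q"
    by (metis inner_ge_zero antisym inner_eq_zero_iff right_minus_eq)
  then show ?thesis using metric_proj_in[OF C, of y] by (simp add: q_def)
qed

section \<open>The relaxation parameters\<close>

text \<open>The product formula says that the quadratic form
  \<open>|u|^2/l + |v|^2/m + u \<bullet> v - |u + v|^2/\<nu>\<close> has discriminant zero. This is
  the purpose of \<nu>: what remains after splitting off \<open>|u + v|^2/\<nu>\<close> is a single
  square.\<close>

lemma relaxation_parameter:
  fixes l m \<nu> :: real
  assumes l: "l > 0" and m: "m > 0" and lm: "l * m < 4"
    and nu: "\<nu> = 4 * (l + m - l * m) / (4 - l * m)"
  shows "\<nu> > 0" and "1 / \<nu> \<le> 1 / l"
    and "(1 / l - 1 / \<nu>) * (1 / m - 1 / \<nu>) = ((1 - 2 / \<nu>) / 2)\<^sup>2"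
proof -
  \<comment> \<open>Squared form of \<open>l * m < 2 * sqrt (l * m) \<le> l + m\<close>, which makes
    the numerator of \<nu> positive.\<close>
  have "(l * m)\<^sup>2 < 4 * (l * m)"
    using l m lm by (simp add: power2_eq_square)
  also have "4 * (l * m) \<le> (l + m)\<^sup>2"
    using zero_le_power2[of "l - m"] by (simp add: power2_eq_square algebra_simps)
  finally have D: "0 < l + m - l * m"
    using l m power_less_imp_less_base[of "l * m" 2 "l + m"] by simp
  then show nu0: "\<nu> > 0" using lm nu by simp
  have "\<nu> - l = m * (2 - l)\<^sup>2 / (4 - l * m)"
    using lm unfolding nu by (simp add: field_simps power2_eq_square)
  also have "\<dots> \<ge> 0" using lm m by simp
  finally have "l \<le> \<nu>" by simp
  then show "1 / \<nu> \<le> 1 / l" using l by (simp add: frac_le)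
  have inv: "1 / \<nu> = (4 - l * m) / (4 * (l + m - l * m))" unfolding nu by simp
  \<comment> \<open>Expanding both sides of the product formula and cancelling
    \<open>1 / \<nu>^2\<close> leaves exactly this identity.\<close>
  have "(1 / l + 1 / m - 1) * (1 / \<nu>) = 1 / (l * m) - 1 / 4"
    unfolding inv using D l m by (simp add: divide_simps) (simp add: algebra_simps)
  then show "(1 / l - 1 / \<nu>) * (1 / m - 1 / \<nu>) = ((1 - 2 / \<nu>) / 2)\<^sup>2"
    by (simp add: algebra_simps power2_eq_square)
qed

text \<open>The product formula fixes \<open>2 * s * t\<close> only up to sign, as the absolute
  value of \<open>1 - 2 / \<nu>\<close>. The sign \<sigma> is chosen so that
  \<open>|s u - \<sigma> t v|^2\<close> has the right cross term, and
  \<open>s + \<sigma> * t\<close> is the determinant for recovering \<open>u\<close> and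
  \<open>v\<close> from the two combinations.\<close>

lemma relaxation_sign:
  fixes l m \<nu> s t :: real
  assumes l: "l > 0" and m: "m > 0" and lm: "l * m < 4"
    and nu: "\<nu> = 4 * (l + m - l * m) / (4 - l * m)"
    and s: "s = sqrt (1 / l - 1 / \<nu>)" and t: "t = sqrt (1 / m - 1 / \<nu>)"
  obtains \<sigma> :: real where "\<bar>\<sigma>\<bar> = 1" "1 - 2 / \<nu> = - 2 * \<sigma> * s * t" "s + \<sigma> * t \<noteq> 0"
proof -
  note par = relaxation_parameter[OF l m lm nu]
  have s2: "s\<^sup>2 = 1 / l - 1 / \<nu>" using par(2) by (simp add: s)
  have "1 / \<nu> \<le> 1 / m"
    using relaxation_parameter(2)[of m l \<nu>] l m lm nu by (simp add: algebra_simps)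
  then have t2: "t\<^sup>2 = 1 / m - 1 / \<nu>" and st0: "0 \<le> s" "0 \<le> t"
    using par(2) by (simp_all add: s t)
  have "s * t = \<bar>(1 - 2 / \<nu>) / 2\<bar>"
    unfolding s t real_sqrt_mult[symmetric] par(3) by (rule real_sqrt_abs)
  then have st: "2 * (s * t) = \<bar>1 - 2 / \<nu>\<bar>" by simp
  define \<sigma> :: real where "\<sigma> = (if 1 - 2 / \<nu> \<le> 0 then 1 else -1)"
  show ?thesis
  proof
    show "\<bar>\<sigma>\<bar> = 1" by (simp add: \<sigma>_def)
    show "1 - 2 / \<nu> = - 2 * \<sigma> * s * t" using st by (auto simp: \<sigma>_def)
    \<comment> \<open>If the sum vanished, squaring would give \<open>l = m\<close>. Then
      \<open>1 - 2 / \<nu>\<close> is negative, so \<sigma> is 1 and \<open>s = t = 0\<close>,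
      against \<open>2 * (s * t) = \<bar>1 - 2 / \<nu>\<bar>\<close>.\<close>
    show "s + \<sigma> * t \<noteq> 0"
    proof
      assume *: "s + \<sigma> * t = 0"
      have "s\<^sup>2 = (\<sigma> * t)\<^sup>2" using * by (metis add_eq_0_iff power2_minus)
      then have "s\<^sup>2 = t\<^sup>2" by (simp add: \<sigma>_def split: if_splits)
      then have "l = m" using s2 t2 l m by simp
      have l2: "l < 2"
        using lm \<open>l = m\<close> l power_less_imp_less_base[of l 2 2] by (simp add: power2_eq_square)
      have "\<nu> = 4 * l / (2 + l)"
        using l l2 lm unfolding nu \<open>l = m\<close>[symmetric] by (simp add: divide_simps) (simp add: algebra_simps)
      then have "1 - 2 / \<nu> = (l - 2) / (2 * l)"
        using l par(1) by (simp add: divide_simps) (simp add: algebra_simps)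
      also have "\<dots> < 0" using l l2 by (simp add: field_simps)
      finally show False using * st0 st by (auto simp: \<sigma>_def add_nonneg_eq_0_iff)
    qed
  qed
qed

section \<open>The displacement of the composition\<close>

text \<open>The first step has length \<open>l * infdist x A\<close>. For \<open>B\<close>, the
  point \<open>p = metric_proj B y\<close> is compared with \<open>x\<close>: through the two steps
  if \<open>m \<le> 1\<close>, and otherwise through \<open>y\<close> and \<open>w\<close>, which is
  where the bound on \<open>norm (w - x)\<close> enters. In the latter case the factor 2 comes from
  \<open>min l m < 2\<close>, a consequence of \<open>l * m < 4\<close>.\<close>

lemma infdist_relaxed_step_le:
  fixes A B :: "'a::{real_inner,complete_space} set"
  assumes A: "closed A" "convex A" and B: "closed B" "convex B" and ne: "A \<inter> B \<noteq> {}"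
    and l: "l > 0" and m: "m > 0" and lm: "l * m < 4"
    and y: "y = relaxation (metric_proj A) l x"
    and w: "w = relaxation (metric_proj B) m y"
    and M: "norm (y - x) \<le> M" "norm (w - y) \<le> M" "norm (w - x) \<le> M"
  shows "min l m * max (infdist x A) (infdist x B) \<le> 2 * M"
proof -
  have neA: "A \<noteq> {}" and neB: "B \<noteq> {}" using ne by auto
  have "min l m * min l m \<le> l * m" using l m by (intro mult_mono) auto
  then have "(min l m)\<^sup>2 < 2\<^sup>2" using lm by (simp add: power2_eq_square)
  then have min2: "min l m < 2" by (rule power_less_imp_less_base) simp
  have M0: "0 \<le> M" using M(1) norm_ge_zero order_trans by blast
  have "l * infdist x A = norm (y - x)"
    using l by (simp add: y relaxation_def infdist_metric_proj[OF A neA] norm_minus_commute)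
  moreover have "min l m * infdist x A \<le> l * infdist x A"
    by (intro mult_right_mono) (auto simp: infdist_nonneg)
  ultimately have 1: "min l m * infdist x A \<le> 2 * M" using M(1) M0 by linarith
  define p where "p = metric_proj B y"
  have wy: "w - y = m *\<^sub>R (p - y)" by (simp add: w relaxation_def p_def)
  have dB: "infdist x B \<le> norm (p - x)"
    using infdist_le[OF metric_proj_in[OF B neB], of x y]
    by (simp add: p_def dist_norm norm_minus_commute)
  have 2: "min l m * infdist x B \<le> 2 * M"
  proof (cases "m \<le> 1")
    case True
    have "m *\<^sub>R (p - x) = m *\<^sub>R (y - x) + (w - y)"
      by (simp add: wy algebra_simps)
    then have "m * norm (p - x) \<le> m * norm (y - x) + norm (w - y)"
      using norm_triangle_ineq[of "m *\<^sub>R (y - x)" "w - y"] m by (metis abs_of_pos norm_scaleR)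
    also have "\<dots> \<le> 1 * M + M"
      using True M m M0 by (intro add_mono mult_mono) auto
    finally have "m * norm (p - x) \<le> 2 * M" by simp
    moreover have "min l m * infdist x B \<le> m * norm (p - x)"
      using dB m by (intro mult_mono) (auto simp: infdist_nonneg)
    ultimately show ?thesis by linarith
  next
    case False
    \<comment> \<open>Now \<open>p\<close> lies on the segment between \<open>y\<close> and \<open>w\<close>.\<close>
    have "m *\<^sub>R (p - x) = (m - 1) *\<^sub>R (y - x) + (w - x)"
      using wy by (simp add: algebra_simps)
    then have "m * norm (p - x) \<le> (m - 1) * norm (y - x) + norm (w - x)"
      using norm_triangle_ineq[of "(m - 1) *\<^sub>R (y - x)" "w - x"] False
      by (metis abs_of_pos diff_gt_0_iff_gt m norm_scaleR not_le)
    also have "\<dots> \<le> (m - 1) * M + M"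
      using False M by (intro add_mono mult_left_mono) auto
    finally have "m * norm (p - x) \<le> m * M" by (simp add: algebra_simps)
    then have "infdist x B \<le> M" using m dB by simp
    then show ?thesis
      using min2 l m M0 by (intro mult_mono) (auto simp: infdist_nonneg)
  qed
  from 1 2 show ?thesis by (simp add: max_def)
qed

text \<open>The displacement inequalities of the two projections, at \<open>x\<close> and at
  \<open>y\<close>, are scaled by \<open>l\<close> and \<open>m\<close> and added. Replacing
  \<open>c - y\<close> by \<open>c - x\<close> in the second produces the cross term.\<close>

lemma relaxed_composition_displacement:
  fixes A B :: "'a::{real_inner,complete_space} set"
  assumes A: "closed A" "convex A" and B: "closed B" "convex B"
    and l: "l > 0" and m: "m > 0"
    and y: "y = relaxation (metric_proj A) l x"
    and w: "w = relaxation (metric_proj B) m y"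
    and c: "c \<in> A \<inter> B"
  shows "(norm (y - x))\<^sup>2 / l + (norm (w - y))\<^sup>2 / m + (y - x) \<bullet> (w - y) \<le> (w - x) \<bullet> (c - x)"
proof -
  define a where "a = metric_proj A x - x"
  define b where "b = metric_proj B y - y"
  have yx: "y - x = l *\<^sub>R a" and wy: "w - y = m *\<^sub>R b"
    by (simp_all add: y w relaxation_def a_def b_def)
  have "l * (norm a)\<^sup>2 \<le> l * (a \<bullet> (c - x))" "m * (norm b)\<^sup>2 \<le> m * (b \<bullet> (c - y))"
    using metric_proj_displacement[OF A, of c x] metric_proj_displacement[OF B, of c y] c l m
    by (simp_all add: a_def b_def)
  then have "(norm (y - x))\<^sup>2 / l \<le> (y - x) \<bullet> (c - x)" "(norm (w - y))\<^sup>2 / m \<le> (w - y) \<bullet> (c - y)"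
    using l m by (simp_all add: yx wy power_mult_distrib power2_eq_square)
  moreover have "(y - x) \<bullet> (c - x) + (w - y) \<bullet> (c - y) + (y - x) \<bullet> (w - y) = (w - x) \<bullet> (c - x)"
    by (simp add: inner_diff_left inner_diff_right inner_commute)
  ultimately show ?thesis by linarith
qed

text \<open>Solves the two combinations \<open>u + v\<close> and \<open>s u - \<sigma> t v\<close>
  for \<open>u\<close> and \<open>v\<close>; the determinant of this system is
  \<open>s + \<sigma> * t\<close>.\<close>

lemma norm_le_of_combinations:
  fixes u v :: "'a::real_inner"
  assumes s: "0 \<le> s" "s \<le> \<beta>" and t: "0 \<le> t" "t \<le> \<beta>" and \<sigma>: "\<bar>\<sigma>\<bar> = 1"
    and c: "c \<le> \<bar>s + \<sigma> * t\<bar>"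
  shows "c * norm u \<le> \<beta> * norm (u + v) + norm (s *\<^sub>R u - (\<sigma> * t) *\<^sub>R v)"
    and "c * norm v \<le> \<beta> * norm (u + v) + norm (s *\<^sub>R u - (\<sigma> * t) *\<^sub>R v)"
proof -
  let ?f = "s *\<^sub>R u - (\<sigma> * t) *\<^sub>R v"
  have \<sigma>t: "\<bar>\<sigma> * t\<bar> = t" using t \<sigma> by (simp add: abs_mult)
  have "(s + \<sigma> * t) *\<^sub>R u = (\<sigma> * t) *\<^sub>R (u + v) + ?f" by (simp add: algebra_simps)
  then have "\<bar>s + \<sigma> * t\<bar> * norm u \<le> t * norm (u + v) + norm ?f"
    using norm_triangle_ineq[of "(\<sigma> * t) *\<^sub>R (u + v)" ?f] \<sigma>t by (metis norm_scaleR)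
  moreover have "c * norm u \<le> \<bar>s + \<sigma> * t\<bar> * norm u" "t * norm (u + v) \<le> \<beta> * norm (u + v)"
    using c t by (auto intro: mult_right_mono)
  ultimately show "c * norm u \<le> \<beta> * norm (u + v) + norm ?f" by linarith
  have "(s + \<sigma> * t) *\<^sub>R v = s *\<^sub>R (u + v) - ?f" by (simp add: algebra_simps)
  then have "\<bar>s + \<sigma> * t\<bar> * norm v \<le> s * norm (u + v) + norm ?f"
    using norm_triangle_ineq4[of "s *\<^sub>R (u + v)" ?f] s by (metis abs_of_nonneg norm_scaleR)
  moreover have "c * norm v \<le> \<bar>s + \<sigma> * t\<bar> * norm v" "s * norm (u + v) \<le> \<beta> * norm (u + v)"
    using c s by (auto intro: mult_right_mono)
  ultimately show "c * norm v \<le> \<beta> * norm (u + v) + norm ?f" by linarith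
qed

text \<open>The constant \<open>c\<close> stands in for \<open>\<bar>s - t\<bar>\<close>, which
  vanishes for \<open>l = m\<close>: it is at least as large and always positive, so one estimate
  serves both the qualitative statements and the explicit \<delta>.\<close>

lemma relaxed_composition_error_bound:
  fixes A B :: "'a::{real_inner,complete_space} set"
  assumes A: "closed A" "convex A" and B: "closed B" "convex B"
    and l: "l > 0" and m: "m > 0" and lm: "l * m < 4"
    and T: "T = relaxation (metric_proj B) m \<circ> relaxation (metric_proj A) l"
    and nu: "\<nu> = 4 * (l + m - l * m) / (4 - l * m)"
    and s: "s = sqrt (1 / l - 1 / \<nu>)" and t: "t = sqrt (1 / m - 1 / \<nu>)"
    and \<beta>: "\<beta> = max s t"
  obtains c where "c > 0" "\<bar>s - t\<bar> \<le> c" "c \<le> \<beta>"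
    "\<And>x z. z \<in> A \<inter> B \<Longrightarrow> c * (min l m * max (infdist x A) (infdist x B))
        \<le> 2 * (1 + \<beta> * sqrt \<nu>) * sqrt (norm (T x - x) * dist x z)"
proof -
  note par = relaxation_parameter[OF l m lm nu]
  have "1 / \<nu> \<le> 1 / m"
    using relaxation_parameter(2)[of m l \<nu>] l m lm nu by (simp add: algebra_simps)
  then have s2: "s\<^sup>2 = 1 / l - 1 / \<nu>" and t2: "t\<^sup>2 = 1 / m - 1 / \<nu>"
    and st0: "0 \<le> s" "0 \<le> t"
    using par(2) by (simp_all add: s t)
  obtain \<sigma> :: real where \<sigma>: "\<bar>\<sigma>\<bar> = 1" and st: "1 - 2 / \<nu> = - 2 * \<sigma> * s * t"
    and ne: "s + \<sigma> * t \<noteq> 0"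
    using relaxation_sign[OF l m lm nu s t] .
  \<comment> \<open>The cap at \<beta> gives \<open>c * e \<le> \<beta> * e\<close>, so that the
    whole displacement, like the two steps, is bounded by \<open>M / c\<close>.\<close>
  define c where "c = min \<bar>s + \<sigma> * t\<bar> \<beta>"
  have "\<beta> > 0" using ne st0 by (auto simp: \<beta> max_def not_le less_eq_real_def)
  then have c0: "c > 0" using ne by (simp add: c_def)
  have sc: "\<bar>s - t\<bar> \<le> c" using st0 \<sigma> by (auto simp: c_def \<beta> abs_if split: if_splits)
  have est: "c * (min l m * max (infdist x A) (infdist x B))
        \<le> 2 * (1 + \<beta> * sqrt \<nu>) * sqrt (norm (T x - x) * dist x z)" if z: "z \<in> A \<inter> B" for x z
  proof -
    define y where "y = relaxation (metric_proj A) l x"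
    have Tx: "T x = relaxation (metric_proj B) m y" by (simp add: T y_def)
    define u where "u = y - x"
    define v where "v = T x - y"
    define e where "e = norm (u + v)"
    define f where "f = s *\<^sub>R u - (\<sigma> * t) *\<^sub>R v"
    have uv: "u + v = T x - x" by (simp add: u_def v_def)
    have \<sigma>2: "\<sigma>\<^sup>2 = 1" using \<sigma> by (metis one_power2 power2_abs)
    have "(norm f)\<^sup>2 = s\<^sup>2 * (norm u)\<^sup>2 + \<sigma>\<^sup>2 * t\<^sup>2 * (norm v)\<^sup>2 + (- 2 * \<sigma> * s * t) * (u \<bullet> v)"
      unfolding f_def power2_norm_eq_inner
      by (simp add: inner_diff_left inner_diff_right inner_commute power2_eq_square algebra_simps)
    also have "\<dots> = (1 / l - 1 / \<nu>) * (norm u)\<^sup>2 + (1 / m - 1 / \<nu>) * (norm v)\<^sup>2 + (1 - 2 / \<nu>) * (u \<bullet> v)"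
      unfolding \<sigma>2 st[symmetric] s2 t2 by simp
    also have "\<dots> = (norm u)\<^sup>2 / l + (norm v)\<^sup>2 / m + u \<bullet> v - e\<^sup>2 / \<nu>"
      unfolding e_def power2_norm_eq_inner
      by (simp add: inner_add_left inner_add_right inner_commute algebra_simps add_divide_distrib)
    also have "\<dots> \<le> (u + v) \<bullet> (z - x) - e\<^sup>2 / \<nu>"
      using relaxed_composition_displacement[OF A B l m y_def Tx z]
      unfolding uv by (simp add: u_def v_def)
    also have "\<dots> \<le> e * dist x z - e\<^sup>2 / \<nu>"
      using norm_cauchy_schwarz[of "u + v" "z - x"] by (simp add: e_def dist_norm norm_minus_commute)
    finally have f2: "(norm f)\<^sup>2 \<le> e * dist x z - e\<^sup>2 / \<nu>" .
    \<comment> \<open>In \<open>f2\<close> either nonnegative square may be dropped; this bounds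
      first \<open>norm f\<close> and then \<open>e\<close> by multiples of
      \<open>sqrt (e * dist x z)\<close>.\<close>
    have "0 \<le> e\<^sup>2 / \<nu>" using par(1) by simp
    then have "(norm f)\<^sup>2 \<le> e * dist x z" using f2 by linarith
    then have nf: "norm f \<le> sqrt (e * dist x z)" by (rule real_le_rsqrt)
    have "e\<^sup>2 / \<nu> \<le> e * dist x z" using f2 zero_le_power2[of "norm f"] by linarith
    then have "e\<^sup>2 \<le> \<nu> * (e * dist x z)" using par(1) by (simp add: field_simps)
    then have "e \<le> sqrt \<nu> * sqrt (e * dist x z)"
      unfolding real_sqrt_mult[symmetric] by (rule real_le_rsqrt)
    then have be: "\<beta> * e \<le> \<beta> * sqrt \<nu> * sqrt (e * dist x z)"
      using \<open>\<beta> > 0\<close> by simp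
    define M where "M = \<beta> * e + norm f"
    have M: "M \<le> (1 + \<beta> * sqrt \<nu>) * sqrt (e * dist x z)"
      using nf be by (simp add: M_def algebra_simps)
    have comb: "c * norm u \<le> M" "c * norm v \<le> M"
      unfolding M_def e_def f_def
      using st0 \<sigma> by (auto intro!: norm_le_of_combinations simp: \<beta> c_def)
    have "c * e \<le> \<beta> * e" by (intro mult_right_mono) (auto simp: c_def e_def)
    then have "c * e \<le> M" by (simp add: M_def add_increasing2)
    then have "min l m * max (infdist x A) (infdist x B) \<le> 2 * (M / c)"
      using comb c0 z
      by (intro infdist_relaxed_step_le[OF A B _ l m lm y_def Tx])
        (auto simp: field_simps u_def v_def e_def)
    then have "c * (min l m * max (infdist x A) (infdist x B)) \<le> 2 * M"
      using c0 by (simp add: field_simps)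
    also have "\<dots> \<le> 2 * (1 + \<beta> * sqrt \<nu>) * sqrt (e * dist x z)"
      unfolding mult.assoc[of 2] using M by (rule mult_left_mono) simp
    finally show ?thesis by (simp only: e_def uv)
  qed
  show ?thesis by (rule that[OF c0 sc _ est]) (simp_all add: c_def)
qed

section \<open>From the error bound to regularity of the composition\<close>

text \<open>Squaring and dividing by \<open>e\<close> isolates \<open>dist x c\<close>, so the
  infimum over \<open>c\<close> can be taken. For \<open>e = 0\<close> the assumption already forces
  \<open>K = 0\<close>.\<close>

lemma power2_le_mult_infdist:
  assumes "C \<noteq> {}" "0 \<le> e" "0 \<le> K" "\<And>c. c \<in> C \<Longrightarrow> K \<le> sqrt (e * dist x c)"
  shows "K\<^sup>2 \<le> e * infdist x C"
proof (cases "e = 0")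
  case True
  then show ?thesis using assms by fastforce
next
  case False
  have "K\<^sup>2 / e \<le> dist x c" if "c \<in> C" for c
  proof -
    have "K\<^sup>2 \<le> (sqrt (e * dist x c))\<^sup>2" using assms that by (intro power_mono) auto
    then show ?thesis using False assms by (simp add: field_simps)
  qed
  then have "K\<^sup>2 / e \<le> infdist x C"
    using assms by (auto simp: infdist_notempty intro: cINF_greatest)
  then show ?thesis using False assms by (simp add: field_simps)
qed

text \<open>For \<open>lam = \<mu>\<close> the two roots coincide and \<alpha> is 0, so the claims
  on \<alpha> and on linear regularity carry the condition \<open>lam \<noteq> \<mu>\<close>. The
  first two statements rest on the positive constant \<open>c\<close> instead.\<close>

theorem corollary3p5:
  fixes A B :: "'a::{real_inner,complete_space} set"
    and z :: 'a
    and lam \<mu> r \<nu> \<alpha> \<beta> :: real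
    and T :: "'a \<Rightarrow> 'a"
  assumes "closed A" and "convex A" and "closed B" and "convex B"
    and "lam > 0" and "\<mu> > 0" and "lam * \<mu> < 4"
    and "A \<inter> B \<noteq> {}"
    and "z \<in> A \<inter> B" and "r > 0"
    and T: "T = relaxation (metric_proj B) \<mu> \<circ> relaxation (metric_proj A) lam"
    and nu: "\<nu> = 4 * (lam + \<mu> - lam * \<mu>) / (4 - lam * \<mu>)"
    and alpha: "\<alpha> = sqrt (1 / lam - 1 / \<nu>) - sqrt (1 / \<mu> - 1 / \<nu>)"
    and beta: "\<beta> = max (sqrt (1 / lam - 1 / \<nu>)) (sqrt (1 / \<mu> - 1 / \<nu>))"
  shows "weakly_regular_op T (cball z r)
    \<and> (regular_pair A B (cball z r) \<longrightarrow> regular_op T (cball z r))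
    \<and> \<beta> > 0
    \<and> (lam \<noteq> \<mu> \<longrightarrow>
         \<alpha> \<noteq> 0
         \<and> (\<forall>\<kappa>. linearly_regular_pair \<kappa> A B (cball z r) \<longrightarrow>
              linearly_regular_op ((\<bar>\<alpha>\<bar> * min lam \<mu> / (2 * \<kappa> * (1 + \<beta> * sqrt \<nu>)))\<^sup>2) T (cball z r)))"
proof -
  note A = assms(1,2) and B = assms(3,4) and l = assms(5) and m = assms(6) and lm = assms(7)
  define s where "s = sqrt (1 / lam - 1 / \<nu>)"
  define t where "t = sqrt (1 / \<mu> - 1 / \<nu>)"
  have \<alpha>: "\<alpha> = s - t" and \<beta>: "\<beta> = max s t" by (simp_all add: alpha beta s_def t_def)
  have \<nu>0: "\<nu> > 0" using relaxation_parameter(1)[OF l m lm nu] .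
  obtain c where c: "c > 0" "\<bar>\<alpha>\<bar> \<le> c" "c \<le> \<beta>"
    and est: "\<And>x w. w \<in> A \<inter> B \<Longrightarrow> c * (min lam \<mu> * max (infdist x A) (infdist x B))
        \<le> 2 * (1 + \<beta> * sqrt \<nu>) * sqrt (norm (T x - x) * dist x w)"
    using relaxed_composition_error_bound[OF A B l m lm T nu s_def t_def \<beta>] unfolding \<alpha> by blast
  have \<beta>0: "\<beta> > 0" using c by linarith
  have G: "1 + \<beta> * sqrt \<nu> > 0" using \<beta>0 \<nu>0 by (simp add: add_pos_nonneg)
  have mn: "min lam \<mu> > 0" using l m by simp
  have neA: "A \<noteq> {}" and neB: "B \<noteq> {}" using assms(8) by auto
  \<comment> \<open>By this inclusion the distance to \<open>Fix T\<close> is at most the distance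
    to \<open>A \<inter> B\<close>, so it suffices to bound the latter.\<close>
  have Fix_sub: "A \<inter> B \<subseteq> Fix T"
    by (auto simp: Fix_def T relaxation_def metric_proj_self[OF A] metric_proj_self[OF B])
  have Fix_le: "infdist x (Fix T) \<le> infdist x (A \<inter> B)" for x
    using infdist_mono[OF Fix_sub assms(8)] .
  \<comment> \<open>Common core of the first two statements: in the error bound at the centre
    \<open>z\<close>, the factor \<open>dist (x k) z\<close> is at most \<open>r\<close> on the
    ball, so the displacement alone drives the right-hand side to 0.\<close>
  have lim: "(\<lambda>k. max (infdist (x k) A) (infdist (x k) B)) \<longlonglongrightarrow> 0"
    if x: "\<And>k. x k \<in> cball z r" and Tx: "(\<lambda>k. norm (T (x k) - x k)) \<longlonglongrightarrow> 0" for x :: "nat \<Rightarrow> 'a"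
  proof (rule tendsto_sandwich[OF _ _ tendsto_const])
    define K where "K = 2 * (1 + \<beta> * sqrt \<nu>) / (c * min lam \<mu>)"
    have "max (infdist (x k) A) (infdist (x k) B) \<le> K * sqrt (norm (T (x k) - x k) * r)" for k
    proof -
      have "c * (min lam \<mu> * max (infdist (x k) A) (infdist (x k) B))
          \<le> 2 * (1 + \<beta> * sqrt \<nu>) * sqrt (norm (T (x k) - x k) * dist (x k) z)"
        using est assms(9) .
      also have "\<dots> \<le> 2 * (1 + \<beta> * sqrt \<nu>) * sqrt (norm (T (x k) - x k) * r)"
        using x[of k] G by (intro mult_left_mono real_sqrt_le_mono) (auto simp: dist_commute)
      finally have "max (infdist (x k) A) (infdist (x k) B) * (c * min lam \<mu>)
          \<le> 2 * (1 + \<beta> * sqrt \<nu>) * sqrt (norm (T (x k) - x k) * r)"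
        by (simp only: mult_ac)
      moreover have "0 < c * min lam \<mu>" using c(1) mn by simp
      ultimately show ?thesis
        unfolding K_def times_divide_eq_left by (simp only: pos_le_divide_eq)
    qed
    then show "\<forall>\<^sub>F k in sequentially. max (infdist (x k) A) (infdist (x k) B)
        \<le> K * sqrt (norm (T (x k) - x k) * r)" by simp
    have "(\<lambda>k. K * sqrt (norm (T (x k) - x k) * r)) \<longlonglongrightarrow> K * sqrt (0 * r)"
      using Tx by (intro tendsto_intros)
    then show "(\<lambda>k. K * sqrt (norm (T (x k) - x k) * r)) \<longlonglongrightarrow> 0" by simp
    show "\<forall>\<^sub>F k in sequentially. 0 \<le> max (infdist (x k) A) (infdist (x k) B)"
      by (simp add: infdist_nonneg le_max_iff_disj)
  qed
  have "weakly_regular_op T (cball z r)"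
    unfolding weakly_regular_op_def
  proof (intro allI impI)
    fix x y
    assume x: "\<forall>k. x k \<in> cball z r" and w: "weakly_converges x y"
      and Tx: "(\<lambda>k. norm (T (x k) - x k)) \<longlonglongrightarrow> 0"
    note max0 = lim[OF _ Tx]
    have "(\<lambda>k. infdist (x k) A) \<longlonglongrightarrow> 0" "(\<lambda>k. infdist (x k) B) \<longlonglongrightarrow> 0"
      using x by (auto intro!: tendsto_sandwich[OF _ _ tendsto_const max0] simp: infdist_nonneg)
    then have "y \<in> A \<inter> B"
      using weak_limit_in_closed_convex[OF A neA w] weak_limit_in_closed_convex[OF B neB w] by blast
    then show "y \<in> Fix T" using Fix_sub by blast
  qed
  moreover have "regular_op T (cball z r)" if "regular_pair A B (cball z r)"
    unfolding regular_op_def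
  proof (intro allI impI)
    fix x :: "nat \<Rightarrow> 'a"
    assume x: "\<forall>k. x k \<in> cball z r" and Tx: "(\<lambda>k. norm (T (x k) - x k)) \<longlonglongrightarrow> 0"
    have "(\<lambda>k. infdist (x k) (A \<inter> B)) \<longlonglongrightarrow> 0"
      using that x lim[OF _ Tx] unfolding regular_pair_def by blast
    then show "(\<lambda>k. infdist (x k) (Fix T)) \<longlonglongrightarrow> 0"
      by (rule tendsto_sandwich[OF _ _ tendsto_const, rotated 2])
        (auto simp: infdist_nonneg Fix_le)
  qed
  moreover have \<alpha>0: "\<alpha> \<noteq> 0" if "lam \<noteq> \<mu>"
    using that l m by (simp add: alpha)
  moreover have "linearly_regular_op ((\<bar>\<alpha>\<bar> * min lam \<mu> / (2 * \<kappa> * (1 + \<beta> * sqrt \<nu>)))\<^sup>2) T (cball z r)"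
    if "lam \<noteq> \<mu>" and reg: "linearly_regular_pair \<kappa> A B (cball z r)" for \<kappa>
  proof -
    have \<kappa>: "\<kappa> > 0" using reg by (simp add: linearly_regular_pair_def)
    define q where "q = \<bar>\<alpha>\<bar> * min lam \<mu> / (2 * \<kappa> * (1 + \<beta> * sqrt \<nu>))"
    have q0: "q > 0" using \<alpha>0[OF that(1)] mn \<kappa> G by (simp add: q_def)
    have "q\<^sup>2 * infdist x (Fix T) \<le> norm (T x - x)" if x: "x \<in> cball z r" for x
    proof -
      define d where "d = infdist x (A \<inter> B)"
      define D where "D = max (infdist x A) (infdist x B)"
      have d0: "0 \<le> d" and D0: "0 \<le> D"
        by (simp_all add: d_def D_def infdist_nonneg le_max_iff_disj)
      have dD: "d \<le> \<kappa> * D"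
        using reg x by (simp add: linearly_regular_pair_def d_def D_def)
      \<comment> \<open>The \<kappa> in the denominator of \<open>q\<close> absorbs the one from
        linear regularity, and the remaining constants are those of the error bound, with
        \<open>\<bar>\<alpha>\<bar> \<le> c\<close>.\<close>
      have "q * d \<le> sqrt (norm (T x - x) * dist x w)" if w: "w \<in> A \<inter> B" for w
      proof -
        have "q * d \<le> q * (\<kappa> * D)" using dD q0 by simp
        also have "\<dots> = \<bar>\<alpha>\<bar> * (min lam \<mu> * D) / (2 * (1 + \<beta> * sqrt \<nu>))"
          using \<kappa> by (simp add: q_def)
        also have "\<dots> \<le> c * (min lam \<mu> * D) / (2 * (1 + \<beta> * sqrt \<nu>))"
          using c(2) mn D0 G by (intro divide_right_mono mult_right_mono) auto
        also have "\<dots> \<le> sqrt (norm (T x - x) * dist x w)"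
          using est[OF w, of x] G by (simp add: D_def pos_divide_le_eq mult.commute)
        finally show ?thesis .
      qed
      \<comment> \<open>Letting \<open>w\<close> vary over \<open>A \<inter> B\<close> turns
        \<open>dist x w\<close> into \<open>d\<close>. One factor \<open>d\<close> then cancels,
        which is why \<delta> is the square of \<open>q\<close>.\<close>
      then have "(q * d)\<^sup>2 \<le> norm (T x - x) * d"
        unfolding d_def using q0
        by (intro power2_le_mult_infdist[OF assms(8)]) (auto simp: infdist_nonneg)
      then have "(q\<^sup>2 * d) * d \<le> norm (T x - x) * d"
        by (simp add: power2_eq_square algebra_simps)
      then have "q\<^sup>2 * d \<le> norm (T x - x)"
        using d0 by (cases "d = 0") (auto simp: mult_le_cancel_right)
      moreover have "q\<^sup>2 * infdist x (Fix T) \<le> q\<^sup>2 * d"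
        using Fix_le by (simp add: d_def mult_left_mono)
      ultimately show ?thesis by linarith
    qed
    then show ?thesis using q0 by (simp add: linearly_regular_op_def q_def[symmetric])
  qed
  ultimately show ?thesis using \<beta>0 by blast
qed

end
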